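(* Let $n\ge 1$ be an integer, let $m$ be a real number with $m\ge n$, and put $d=n/m$. Let $\mathcal U$ be a nonempty finite set and for each $u\in\mathcal U$ let $\alpha_u\in\mathbb R$ and $\beta_u\in[0,1]$; assume there is $u\in\mathcal U$ with $\beta_u\in(0,1]$. For $u\in\mathcal U$ let $M^u$ and $c^u$ be the $n\times n$ matrix and the vector of $\mathbb R^n$ defined in the context. Then the system in the unknown $(\mu,x)\in\mathbb R\times\mathbb R^n$ $$\mu+x_i=\min_{u\in\mathcal U}\left\{(M^u x)_i+c^u_i\right\},\qquad 1\le i\le n,$$ admits the solution $(\mu,x)$ given by $$\mu=\min_{u\in\mathcal U}\left\{\alpha_u+\frac{\beta_u}{d}\right\},\qquad x={}^t\left[0,\ \tfrac1d,\ \tfrac2d,\ \dots,\ \tfrac{n-1}{d}\right],\ \text{ i.e. } x_i=\frac{i-1}{d}.$$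
   Context: The setting is $n$ vehicles on a one-lane circular road of length $m$ (car density $d=n/m$). For $u\in\mathcal U$, the matrix $M^u$ is defined by its action on $x\in\mathbb R^n$: $(M^u x)_i=(1-\beta_u)x_i+\beta_u x_{i+1}$ for $1\le i<n$, and $(M^u x)_n=(1-\beta_u)x_n+\beta_u x_1$. The vector $c^u\in\mathbb R^n$ is given by $c^u_i=\alpha_u$ for $1\le i<n$ and $c^u_n=\alpha_u+n\beta_u/d$. Here ${}^t[\cdot]$ denotes the transpose (column vector). *)

theory Defs
  imports "Jordan_Normal_Form.Matrix"
begin

text \<open>Coordinates are 0-based, following the vector and matrix library: component \<open>i\<close> with
  \<open>1 \<le> i \<le> n\<close> of the text is the component with index \<open>i - 1 < n\<close>. The successor of
  the last index is the first one, hence the index \<open>(i + 1) mod n\<close>.\<close>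

text \<open>Adding the two entries, rather than choosing between them, matters for \<open>n = 1\<close>,
  where both contribute to the same position.\<close>

definition traffic_mat :: "nat \<Rightarrow> real \<Rightarrow> real mat" where
  "traffic_mat n b = mat n n (\<lambda>(i, j).
     (if j = i then 1 - b else 0) + (if j = (i + 1) mod n then b else 0))"

text \<open>The matrix acts in the way by which it is introduced in the text.\<close>

lemma traffic_mat_mult:
  assumes "x \<in> carrier_vec n" and "i < n"
  shows "(traffic_mat n b *\<^sub>v x) $ i =
    (if i + 1 < n then (1 - b) * x $ i + b * x $ (i + 1) else (1 - b) * x $ i + b * x $ 0)"
proof -
  have "(traffic_mat n b *\<^sub>v x) $ i =
      (\<Sum>j = 0..<n. ((if j = i then 1 - b else 0) + (if j = (i + 1) mod n then b else 0)) * x $ j)"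
    using assms by (simp add: traffic_mat_def scalar_prod_def)
  also have "\<dots> = (\<Sum>j = 0..<n. if j = i then (1 - b) * x $ j else 0)
      + (\<Sum>j = 0..<n. if j = (i + 1) mod n then b * x $ j else 0)"
    unfolding sum.distrib [symmetric] by (rule sum.cong) (auto simp: algebra_simps)
  also have "\<dots> = (1 - b) * x $ i + b * x $ ((i + 1) mod n)"
    using assms by (simp add: sum.delta)
  also have "(i + 1) mod n = (if i + 1 < n then i + 1 else 0)"
    using assms by (simp add: mod_Suc)
  finally show ?thesis by simp
qed

text \<open>Vehicle \<open>n\<close> follows vehicle \<open>1\<close> one lap ahead on the circular road of length
  \<open>m = n / d\<close>, which gives the extra term \<open>n * b / d\<close> in the last component.\<close>

definition traffic_vec :: "nat \<Rightarrow> real \<Rightarrow> real \<Rightarrow> real \<Rightarrow> real vec" where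
  "traffic_vec n d a b = vec n (\<lambda>i. if i + 1 < n then a else a + real n * b / d)"

definition is_solution ::
  "nat \<Rightarrow> real \<Rightarrow> 'u set \<Rightarrow> ('u \<Rightarrow> real) \<Rightarrow> ('u \<Rightarrow> real) \<Rightarrow> real \<Rightarrow> real vec \<Rightarrow> bool" where
  "is_solution n d U \<alpha> \<beta> \<mu> x \<longleftrightarrow>
     x \<in> carrier_vec n \<and>
     (\<forall>i<n. \<mu> + x $ i =
       Min ((\<lambda>u. (traffic_mat n (\<beta> u) *\<^sub>v x) $ i + traffic_vec n d (\<alpha> u) (\<beta> u) $ i) ` U))"

end

theory Submission
  imports Defs
begin

text \<open>With equal spacing 1/d, every vehicle sees the same gap 1/d ahead of it, so each u moves
  all vehicles by the same amount \<alpha> u + \<beta> u / d (\<open>traffic_step_uniform\<close>).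
  The minimizing u is thus the same for every component.\<close>

lemma traffic_step_uniform:
  assumes "i < n"
  shows "(traffic_mat n b *\<^sub>v vec n (\<lambda>i. real i / d)) $ i + traffic_vec n d a b $ i
    = (a + b / d) + real i / d"
proof (cases "i + 1 < n")
  case True
  with assms show ?thesis
    by (simp add: traffic_mat_mult traffic_vec_def algebra_simps add_divide_distrib diff_divide_distrib)
next
  case False
  \<comment> \<open>At the wrap-around the successor entry is 0: the convex combination loses
    \<open>b * i / d\<close>, the lap term adds \<open>n * b / d\<close>, and n - i = 1 leaves
    \<open>b / d\<close>.\<close>
  with assms have "real n = real i + 1" by linarith
  with False assms show ?thesis
    by (simp add: traffic_mat_mult traffic_vec_def algebra_simps add_divide_distrib diff_divide_distrib)
qed

theorem theorem5:
  fixes n :: nat and m d :: real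
    and U :: "'u set" and \<alpha> \<beta> :: "'u \<Rightarrow> real"
  assumes "n \<ge> 1" and "m \<ge> real n" and "d = real n / m"
    and "finite U" and "U \<noteq> {}"
    and "\<And>u. u \<in> U \<Longrightarrow> \<beta> u \<in> {0..1}"
    and "\<exists>u\<in>U. \<beta> u \<in> {0<..1}"
  shows "is_solution n d U \<alpha> \<beta>
           (Min ((\<lambda>u. \<alpha> u + \<beta> u / d) ` U))
           (vec n (\<lambda>i. real i / d))"
  \<comment> \<open>The summand \<open>real i / d\<close> does not depend on u, so it leaves the
    minimum over the finite nonempty set U.\<close>
  using \<open>finite U\<close> \<open>U \<noteq> {}\<close>
  by (simp add: is_solution_def traffic_step_uniform Min_add_commute)

end
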